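(* Let $f\in C_p(\mathbb{R})$, $\mu_j\in\mathbb{R}$, $\sigma_j>0$, and let $q_j(x)=a_j+b_jx+c_jx^2$ be the minimizer, among all polynomials $q$ of degree at most $2$, of $$\int_{\mathbb{R}}|q(x)-f(x)|^2\,\Gamma_{\mu_j,\sigma_j}(x)\,dx.$$ Then $\nabla F(\mu_j,\sigma_j)=\nabla F^{q_j}(\mu_j,\sigma_j)$.
   Context: $C_p(\mathbb{R})$ is the set of continuous functions $f:\mathbb{R}\to\mathbb{R}$ such that $\lim_{|x|\to\infty}f(x)/|x|^m=0$ for some $m>0$. For $\mu\in\mathbb{R}$, $\sigma>0$, $\Gamma_{\mu,\sigma}(x)=\frac{1}{\sqrt{2\pi}\,\sigma}e^{-(x-\mu)^2/(2\sigma^2)}$, $F(\mu,\sigma)=\int_{\mathbb{R}}f(x)\Gamma_{\mu,\sigma}(x)\,dx$, and $F^{q}(\mu,\sigma)=\int_{\mathbb{R}}q(x)\Gamma_{\mu,\sigma}(x)\,dx$. $\nabla$ is the gradient in $(\mu,\sigma)$. *)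

theory Defs
  imports "HOL-Probability.Probability" "HOL-Computational_Algebra.Polynomial"
begin

definition C_p :: "(real \<Rightarrow> real) set" where
  "C_p = {f. continuous_on UNIV f \<and>
            (\<exists>m>0::real. ((\<lambda>x. f x / \<bar>x\<bar> powr m) \<longlongrightarrow> 0) at_infinity)}"

text \<open>
  The domain of interest is the open half-plane of \<^term>\<open>(\<mu>, \<sigma>)\<close> with \<^term>\<open>\<sigma> > (0::real)\<close>.
  There \<^const>\<open>normal_density\<close>, whose normalising factor is written
  \<^term>\<open>1 / sqrt (2 * pi * \<sigma>\<^sup>2)\<close>, is the Gaussian with factor
  \<^term>\<open>1 / (sqrt (2 * pi) * \<sigma>)\<close>.  Mean and standard deviation form one pair, so that
  the gradient is taken in both variables jointly.
\<close>

definition gauss_integral :: "(real \<Rightarrow> real) \<Rightarrow> real \<times> real \<Rightarrow> real" where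
  "gauss_integral f = (\<lambda>(\<mu>, \<sigma>). LINT x|lborel. f x * normal_density \<mu> \<sigma> x)"

definition gauss_sq_error :: "(real \<Rightarrow> real) \<Rightarrow> real \<Rightarrow> real \<Rightarrow> real poly \<Rightarrow> real" where
  "gauss_sq_error f \<mu> \<sigma> q = (LINT x|lborel. \<bar>poly q x - f x\<bar>\<^sup>2 * normal_density \<mu> \<sigma> x)"

end

theory Submission
  imports Defs
begin

text \<open>
  Differentiating under the integral sign gives
  \<open>\<nabla>F(\<mu>, \<sigma>) = (\<integral> f s\<^sub>1 \<Gamma>, \<integral> f s\<^sub>2 \<Gamma>)\<close>, where the scores
  \<open>s\<^sub>1 = (x - \<mu>) / \<sigma>\<^sup>2\<close> and \<open>s\<^sub>2 = (x - \<mu>)\<^sup>2 / \<sigma>\<^sup>3 - 1 / \<sigma>\<close> are polynomials of degree at most 2.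
  The minimality of \<open>q\<close> says that \<open>q - f\<close> is orthogonal in \<open>L\<^sup>2(\<Gamma>)\<close> to all such
  polynomials, so the gradient of \<open>F\<close> does not change when \<open>f\<close> is replaced by \<open>q\<close>.
\<close>

section \<open>Differentiation under the integral sign\<close>

text \<open>Dominated convergence applied to the first-order remainder divided by
  \<open>norm (y - y0)\<close>. The bound \<open>w\<close> is uniform over the ball, so it controls
  the difference quotients as well as the derivative at \<open>y0\<close>. The Frechet form lets the
  mean and the standard deviation vary jointly.\<close>

lemma has_derivative_lebesgue_integral:
  fixes g :: "'a::euclidean_space \<Rightarrow> 'b \<Rightarrow> real"
  assumes r: "r > 0"
    and int: "\<And>y. y \<in> ball y0 r \<Longrightarrow> integrable M (g y)"
    and deriv: "\<And>x y. y \<in> ball y0 r \<Longrightarrow> ((\<lambda>y. g y x) has_derivative g' y x) (at y)"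
    and meas: "\<And>h. (\<lambda>x. g' y0 x h) \<in> borel_measurable M"
    and bound: "\<And>x y h. y \<in> ball y0 r \<Longrightarrow> \<bar>g' y x h\<bar> \<le> w x * norm h"
    and w: "integrable M w"
  shows "((\<lambda>y. LINT x|M. g y x) has_derivative (\<lambda>h. LINT x|M. g' y0 x h)) (at y0)"
proof -
  have y0: "y0 \<in> ball y0 r" using r by simp
  have lin: "bounded_linear (g' y0 x)" for x
    using deriv[OF y0] by (rule has_derivative_bounded_linear)
  have int': "integrable M (\<lambda>x. g' y0 x h)" for h
  proof (rule Bochner_Integration.integrable_bound)
    show "integrable M (\<lambda>x. w x * norm h)" using w by simp
    show "AE x in M. norm (g' y0 x h) \<le> norm (w x * norm h)"
      using bound[OF y0] by (intro AE_I2) (smt (verit) real_norm_def)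
  qed (rule meas)
  have bl: "bounded_linear (\<lambda>h. LINT x|M. g' y0 x h)"
  proof (rule bounded_linear_intro[where K = "integral\<^sup>L M w"])
    fix h k
    show "(LINT x|M. g' y0 x (h + k)) = (LINT x|M. g' y0 x h) + (LINT x|M. g' y0 x k)"
      using int' by (simp add: linear_simps[OF lin])
  next
    fix c h
    show "(LINT x|M. g' y0 x (c *\<^sub>R h)) = c *\<^sub>R (LINT x|M. g' y0 x h)"
      using int' by (simp add: linear_simps[OF lin])
  next
    fix h
    have "norm (LINT x|M. g' y0 x h) \<le> (LINT x|M. \<bar>g' y0 x h\<bar>)"
      using integral_norm_bound[of M "\<lambda>x. g' y0 x h"] by simp
    also have "\<dots> \<le> (LINT x|M. w x * norm h)"
      using int' w bound[OF y0] by (intro integral_mono) auto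
    also have "\<dots> = norm h * integral\<^sup>L M w" by simp
    finally show "norm (LINT x|M. g' y0 x h) \<le> norm h * integral\<^sup>L M w" .
  qed
  \<comment> \<open>Mean value inequality on the convex ball: the uniform derivative bound
    \<open>w x\<close> is a Lipschitz constant there.\<close>
  have lip: "\<bar>g y x - g y0 x\<bar> \<le> w x * norm (y - y0)" if "y \<in> ball y0 r" for x y
  proof -
    have "norm (g y x - g y0 x) \<le> w x * norm (y - y0)"
    proof (rule differentiable_bound[where S = "ball y0 r"])
      show "((\<lambda>y. g y x) has_derivative g' z x) (at z within ball y0 r)" if "z \<in> ball y0 r" for z
        using deriv[OF that] by (rule has_derivative_at_withinI)
      show "onorm (g' z x) \<le> w x" if "z \<in> ball y0 r" for z
        using bound[OF that] by (intro onorm_le) simp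
    qed (use that y0 in auto)
    then show ?thesis by simp
  qed
  \<comment> \<open>For fixed \<open>x\<close>, differentiability of \<open>g\<close> at
    \<open>y0\<close> says exactly that \<open>R y x\<close> tends to 0; what remains is to move
    this limit through the integral.\<close>
  define R where "R y x = (g y x - g y0 x - g' y0 x (y - y0)) / norm (y - y0)" for y x
  have Rint: "((LINT x|M. g y x) - (LINT x|M. g y0 x) - (LINT x|M. g' y0 x (y - y0))) / norm (y - y0)
      = (LINT x|M. R y x)" if "y \<in> ball y0 r" for y
    using int[OF that] int[OF y0] int' unfolding R_def by simp
  have "((\<lambda>y. LINT x|M. R y x) \<longlongrightarrow> 0) (at y0 within ball y0 r)"
    \<comment> \<open>Dominated convergence is a statement about sequences, so the limit is tested
      along sequences in the punctured ball.\<close>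
    unfolding tendsto_at_iff_sequentially o_def
  proof (intro allI impI)
    fix X :: "nat \<Rightarrow> 'a"
    assume X: "\<forall>i. X i \<in> ball y0 r - {y0}" and lim: "X \<longlonglongrightarrow> y0"
    have "(\<lambda>i. LINT x|M. R (X i) x) \<longlonglongrightarrow> (LINT x|M. 0)"
    \<comment> \<open>One \<open>w\<close> comes from the Lipschitz estimate for the increment of
      \<open>g\<close>, the other from the bound on the linear term \<open>g' y0\<close>.\<close>
    proof (rule integral_dominated_convergence[where w = "\<lambda>x. 2 * w x"])
      show "R (X i) \<in> borel_measurable M" for i
        using int[of "X i"] X int[OF y0] meas unfolding R_def
        by (intro borel_measurable_divide borel_measurable_diff borel_measurable_const) auto
      show "integrable M (\<lambda>x. 2 * w x)" using w by simp
      show "AE x in M. (\<lambda>i. R (X i) x) \<longlonglongrightarrow> 0"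
      proof (rule AE_I2)
        fix x
        have "((\<lambda>y. R y x) \<longlongrightarrow> 0) (at y0 within ball y0 r)"
          using has_derivative_at_withinI[OF deriv[OF y0], of x "ball y0 r"]
          unfolding R_def has_derivative_within by (simp add: diff_diff_add)
        then show "(\<lambda>i. R (X i) x) \<longlonglongrightarrow> 0"
          using X lim unfolding tendsto_at_iff_sequentially o_def by blast
      qed
      show "AE x in M. norm (R (X i) x) \<le> 2 * w x" for i
      proof (rule AE_I2)
        fix x
        have X': "X i \<in> ball y0 r" and pos: "norm (X i - y0) > 0" using X by auto
        have "\<bar>g (X i) x - g y0 x - g' y0 x (X i - y0)\<bar> \<le> 2 * w x * norm (X i - y0)"
          using lip[OF X', of x] bound[OF y0, of x "X i - y0"] by linarith
        then show "norm (R (X i) x) \<le> 2 * w x"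
          using pos unfolding R_def by (simp add: field_simps abs_mult)
      qed
    qed simp
    then show "(\<lambda>i. LINT x|M. R (X i) x) \<longlonglongrightarrow> 0" by simp
  qed
  then have "((\<lambda>y. ((LINT x|M. g y x) - (LINT x|M. g y0 x) - (LINT x|M. g' y0 x (y - y0))) / norm (y - y0))
      \<longlongrightarrow> 0) (at y0 within ball y0 r)"
    by (rule Lim_transform_within[OF _ r]) (use Rint in \<open>auto simp: dist_commute\<close>)
  then have "((\<lambda>y. LINT x|M. g y x) has_derivative (\<lambda>h. LINT x|M. g' y0 x h)) (at y0 within ball y0 r)"
    unfolding has_derivative_within using bl by (simp add: diff_diff_add)
  then show ?thesis
    using at_within_open[OF y0 open_ball] by simp
qed

section \<open>Functions of polynomial growth\<close>

text \<open>The base \<open>1 + \<bar>x\<bar>\<close> is at least 1, so one bound holds on the whole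
  line and weakens as the natural exponent grows, which gives closure under sums and products.
  Measurability is included so that the predicate alone yields integrability against
  Gaussians.\<close>

definition poly_growth :: "(real \<Rightarrow> real) \<Rightarrow> bool" where
  "poly_growth f \<longleftrightarrow> f \<in> borel_measurable borel \<and> (\<exists>C n. \<forall>x. \<bar>f x\<bar> \<le> C * (1 + \<bar>x\<bar>) ^ n)"

lemma poly_growthI:
  "f \<in> borel_measurable borel \<Longrightarrow> (\<And>x. \<bar>f x\<bar> \<le> C * (1 + \<bar>x\<bar>) ^ n) \<Longrightarrow> poly_growth f"
  unfolding poly_growth_def by blast

lemma poly_growth_const: "poly_growth (\<lambda>x. c)"
  by (rule poly_growthI[where n = 0 and C = "\<bar>c\<bar>"]) auto

lemma poly_growth_id: "poly_growth (\<lambda>x. x)"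
  by (rule poly_growthI[where n = 1 and C = 1]) auto

lemma poly_growth_mult:
  assumes "poly_growth f" "poly_growth g"
  shows "poly_growth (\<lambda>x. f x * g x)"
proof -
  from assms obtain C n D k where fg: "f \<in> borel_measurable borel" "g \<in> borel_measurable borel"
    and f: "\<And>x. \<bar>f x\<bar> \<le> C * (1 + \<bar>x\<bar>) ^ n" and g: "\<And>x. \<bar>g x\<bar> \<le> D * (1 + \<bar>x\<bar>) ^ k"
    unfolding poly_growth_def by metis
  show ?thesis
  proof (rule poly_growthI)
    fix x
    have "\<bar>f x * g x\<bar> \<le> (C * (1 + \<bar>x\<bar>) ^ n) * (D * (1 + \<bar>x\<bar>) ^ k)"
      unfolding abs_mult using f g by (intro mult_mono) (auto intro: order_trans[OF abs_ge_zero])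
    then show "\<bar>f x * g x\<bar> \<le> (C * D) * (1 + \<bar>x\<bar>) ^ (n + k)" by (simp add: power_add mult_ac)
  qed (use fg in measurable)
qed

lemma poly_growth_add:
  assumes "poly_growth f" "poly_growth g"
  shows "poly_growth (\<lambda>x. f x + g x)"
proof -
  from assms obtain C n D k where fg: "f \<in> borel_measurable borel" "g \<in> borel_measurable borel"
    and f: "\<And>x. \<bar>f x\<bar> \<le> C * (1 + \<bar>x\<bar>) ^ n" and g: "\<And>x. \<bar>g x\<bar> \<le> D * (1 + \<bar>x\<bar>) ^ k"
    unfolding poly_growth_def by metis
  \<comment> \<open>Nonnegative constants allow both exponents to be raised to the common value
    \<open>n + k\<close>.\<close>
  have "C \<ge> 0" "D \<ge> 0" using f[of 0] g[of 0] by auto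
  show ?thesis
  proof (rule poly_growthI)
    fix x
    have "C * (1 + \<bar>x\<bar>) ^ n \<le> C * (1 + \<bar>x\<bar>) ^ (n + k)" "D * (1 + \<bar>x\<bar>) ^ k \<le> D * (1 + \<bar>x\<bar>) ^ (n + k)"
      using \<open>C \<ge> 0\<close> \<open>D \<ge> 0\<close> by (intro mult_left_mono power_increasing; simp)+
    then show "\<bar>f x + g x\<bar> \<le> (C + D) * (1 + \<bar>x\<bar>) ^ (n + k)"
      using f[of x] g[of x] unfolding distrib_right by linarith
  qed (use fg in measurable)
qed

lemma poly_growth_poly: "poly_growth (poly p)"
proof (induction p)
  case 0
  show ?case using poly_growth_const[of 0] by simp
next
  case (pCons a p)
  have "poly (pCons a p) = (\<lambda>x. a + x * poly p x)" by auto
  then show ?case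
    using poly_growth_add[OF poly_growth_const[of a] poly_growth_mult[OF poly_growth_id pCons.IH]] by simp
qed

lemma poly_growth_diff:
  assumes "poly_growth f" "poly_growth g"
  shows "poly_growth (\<lambda>x. f x - g x)"
  using poly_growth_add[OF assms(1) poly_growth_mult[OF poly_growth_const[of "-1"] assms(2)]] by simp

lemma poly_growth_abs: "poly_growth f \<Longrightarrow> poly_growth (\<lambda>x. \<bar>f x\<bar>)"
  unfolding poly_growth_def by auto

text \<open>Far out, the limit bounds the quotient by 1; on the remaining compact interval,
  continuity gives a bound \<open>K\<close>. The constant \<open>K + 1\<close> serves both
  regions.\<close>

lemma C_p_poly_growth:
  assumes "f \<in> C_p"
  shows "poly_growth f"
proof -
  from assms obtain m where cont: "continuous_on UNIV f" and "m > 0"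
    and lim: "((\<lambda>x. f x / \<bar>x\<bar> powr m) \<longlongrightarrow> 0) at_infinity"
    unfolding C_p_def by auto
  have "\<forall>\<^sub>F x in at_infinity. dist (f x / \<bar>x\<bar> powr m) 0 < 1"
    using lim by (rule tendstoD) simp
  then obtain b where b: "\<And>x. norm x \<ge> b \<Longrightarrow> dist (f x / \<bar>x\<bar> powr m) 0 < 1"
    unfolding eventually_at_infinity by blast
  \<comment> \<open>Beyond \<open>B\<close> one has \<bar>x\<bar> \<ge> 1, so the real exponent
    \<open>m\<close> can be rounded up to a natural number.\<close>
  define B where "B = max b 1"
  have "compact (f ` cball 0 B)"
    using cont by (intro compact_continuous_image) (auto intro: continuous_on_subset)
  then obtain K where K: "\<And>x. \<bar>x\<bar> \<le> B \<Longrightarrow> \<bar>f x\<bar> \<le> K"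
    using compact_imp_bounded[of "f ` cball 0 B"] by (fastforce simp: bounded_iff)
  have "K \<ge> 0" using K[of 0] unfolding B_def by linarith
  define n where "n = nat \<lceil>m\<rceil>"
  show ?thesis
  proof (rule poly_growthI)
    show "f \<in> borel_measurable borel" using cont by (rule borel_measurable_continuous_onI)
    fix x :: real
    have ge1: "(1 + \<bar>x\<bar>) ^ n \<ge> 1" by (simp add: one_le_power)
    show "\<bar>f x\<bar> \<le> (K + 1) * (1 + \<bar>x\<bar>) ^ n"
    proof (cases "\<bar>x\<bar> \<le> B")
      case True
      have "K * 1 \<le> K * (1 + \<bar>x\<bar>) ^ n" using \<open>K \<ge> 0\<close> ge1 by (rule mult_left_mono[rotated])
      then show ?thesis using K[OF True] ge1 unfolding distrib_right by linarith
    next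
      case False
      then have x: "\<bar>x\<bar> \<ge> 1" "\<bar>x\<bar> \<ge> b" by (auto simp: B_def)
      have "\<bar>f x\<bar> \<le> \<bar>x\<bar> powr m"
        using b[of x] x by (auto simp: dist_norm field_simps)
      also have "\<dots> \<le> \<bar>x\<bar> powr real n"
        using x by (intro powr_mono) (auto simp: n_def intro: real_nat_ceiling_ge)
      also have "\<dots> = \<bar>x\<bar> ^ n" using x by (intro powr_realpow) auto
      also have "\<dots> \<le> (1 + \<bar>x\<bar>) ^ n" by (intro power_mono) auto
      also have "\<dots> \<le> (K + 1) * (1 + \<bar>x\<bar>) ^ n" using \<open>K \<ge> 0\<close> ge1 by (simp add: distrib_right)
      finally show ?thesis .
    qed
  qed
qed

section \<open>Integrability and uniform domination of Gaussians\<close>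

text \<open>Since \<open>1 + \<bar>x\<bar>\<close> is at most
  \<open>\<bar>x - \<mu>\<bar> + (1 + \<bar>\<mu>\<bar>)\<close>, the binomial expansion reduces the
  claim to finiteness of the absolute central moments of the normal distribution.\<close>

lemma integrable_poly_growth_normal:
  assumes f: "poly_growth f" and \<sigma>: "\<sigma> > 0"
  shows "integrable lborel (\<lambda>x. f x * normal_density \<mu> \<sigma> x)"
proof -
  from f obtain C n where meas: "f \<in> borel_measurable borel" and C: "\<And>x. \<bar>f x\<bar> \<le> C * (1 + \<bar>x\<bar>) ^ n"
    unfolding poly_growth_def by blast
  have "C \<ge> 0" using C[of 0] by auto
  have le: "(1 + \<bar>x\<bar>) ^ n \<le> (\<Sum>k\<le>n. of_nat (n choose k) * (1 + \<bar>\<mu>\<bar>) ^ (n - k) * \<bar>x - \<mu>\<bar> ^ k)" for x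
  proof -
    have "(1 + \<bar>x\<bar>) ^ n \<le> (\<bar>x - \<mu>\<bar> + (1 + \<bar>\<mu>\<bar>)) ^ n" by (intro power_mono) auto
    then show ?thesis unfolding binomial_ring by (simp add: mult_ac)
  qed
  let ?w = "\<lambda>x. C * (\<Sum>k\<le>n. of_nat (n choose k) * (1 + \<bar>\<mu>\<bar>) ^ (n - k) *
    (normal_density \<mu> \<sigma> x * \<bar>x - \<mu>\<bar> ^ k))"
  show ?thesis
  proof (rule Bochner_Integration.integrable_bound)
    show "integrable lborel ?w"
      by (intro integrable_mult_right Bochner_Integration.integrable_sum integrable_normal_moment_abs \<sigma>)
    show "AE x in lborel. norm (f x * normal_density \<mu> \<sigma> x) \<le> norm (?w x)"
    proof (rule AE_I2)
      fix x
      have "\<bar>f x\<bar> \<le> C * (\<Sum>k\<le>n. of_nat (n choose k) * (1 + \<bar>\<mu>\<bar>) ^ (n - k) * \<bar>x - \<mu>\<bar> ^ k)"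
        using C[of x] mult_left_mono[OF le[of x] \<open>C \<ge> 0\<close>] by linarith
      then have "\<bar>f x\<bar> * normal_density \<mu> \<sigma> x \<le>
          C * (\<Sum>k\<le>n. of_nat (n choose k) * (1 + \<bar>\<mu>\<bar>) ^ (n - k) * \<bar>x - \<mu>\<bar> ^ k) * normal_density \<mu> \<sigma> x"
        by (intro mult_right_mono) auto
      also have "\<dots> = ?w x"
        by (simp add: sum_distrib_left sum_distrib_right mult_ac)
      finally have "\<bar>f x * normal_density \<mu> \<sigma> x\<bar> \<le> ?w x"
        by (simp add: abs_mult)
      then show "norm (f x * normal_density \<mu> \<sigma> x) \<le> norm (?w x)"
        unfolding real_norm_def by (rule order_trans[OF _ abs_ge_self])
    qed
  qed (use meas in measurable)
qed

text \<open>Supplies one Gaussian that dominates all densities with parameters near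
  \<open>(\<mu>0, s)\<close>. The wider deviation \<open>3 * s\<close> absorbs the changes in the
  exponent up to \<open>exp (1 / 2)\<close>, and 6 is the ratio of \<open>3 * s\<close> to the
  smallest admissible deviation \<open>s / 2\<close>.\<close>

lemma normal_density_le_wider:
  assumes s: "s > 0" and \<mu>: "\<bar>\<mu> - \<mu>0\<bar> \<le> s / 2" and \<sigma>: "s / 2 \<le> \<sigma>" "\<sigma> \<le> 3 * s / 2"
  shows "normal_density \<mu> \<sigma> x \<le> 6 * exp (1 / 2) * normal_density \<mu>0 (3 * s) x"
proof -
  have \<sigma>0: "\<sigma> > 0" using s \<sigma> by linarith
  have sq: "(s / 2)\<^sup>2 \<le> \<sigma>\<^sup>2" "\<sigma>\<^sup>2 \<le> (3 * s / 2)\<^sup>2"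
    using s \<sigma> by (intro power_mono; linarith)+
  have m2: "(\<mu> - \<mu>0)\<^sup>2 \<le> (s / 2)\<^sup>2"
    using \<mu> s by (metis abs_ge_zero power2_abs power_mono)
  \<comment> \<open>This is (u + v)^2 \<le> 2 u^2 + 2 v^2 with u = x - \<mu> and v = \<mu> - \<mu>0.
    As v^2 \<le> \<sigma>^2, division by 4 \<sigma>^2 turns the second term into the additive
    1/2.\<close>
  have "(x - \<mu>0)\<^sup>2 \<le> 2 * (x - \<mu>)\<^sup>2 + 2 * (\<mu> - \<mu>0)\<^sup>2"
    using zero_le_power2[of "(x - \<mu>) - (\<mu> - \<mu>0)"] by (simp add: power2_eq_square algebra_simps)
  then have A: "(x - \<mu>0)\<^sup>2 - 2 * \<sigma>\<^sup>2 \<le> 2 * (x - \<mu>)\<^sup>2" using m2 sq by linarith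
  \<comment> \<open>Here 4 \<sigma>^2 \<le> 9 s^2 \<le> 18 s^2, the last being twice the square of 3
    s.\<close>
  have "(x - \<mu>0)\<^sup>2 / (2 * (3 * s)\<^sup>2) \<le> (x - \<mu>0)\<^sup>2 / (4 * \<sigma>\<^sup>2)"
    using \<sigma>0 s sq by (intro divide_left_mono) (auto simp: power_mult_distrib power_divide)
  also have "\<dots> \<le> (2 * (x - \<mu>)\<^sup>2 + 2 * \<sigma>\<^sup>2) / (4 * \<sigma>\<^sup>2)"
    using A by (intro divide_right_mono) auto
  also have "\<dots> = (x - \<mu>)\<^sup>2 / (2 * \<sigma>\<^sup>2) + 1 / 2"
    using \<sigma>0 by (simp add: field_simps)
  finally have "exp (- (x - \<mu>)\<^sup>2 / (2 * \<sigma>\<^sup>2)) \<le> exp (1 / 2 + - (x - \<mu>0)\<^sup>2 / (2 * (3 * s)\<^sup>2))"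
    by simp
  then have E: "exp (- (x - \<mu>)\<^sup>2 / (2 * \<sigma>\<^sup>2)) \<le> exp (1 / 2) * exp (- (x - \<mu>0)\<^sup>2 / (2 * (3 * s)\<^sup>2))"
    unfolding exp_add .
  have "1 / sqrt (2 * pi * \<sigma>\<^sup>2) = 1 / (sqrt (2 * pi) * \<sigma>)"
    using \<sigma>0 by (simp add: real_sqrt_mult)
  also have "\<dots> \<le> 1 / (sqrt (2 * pi) * (s / 2))"
    using s \<sigma> \<sigma>0 by (intro divide_left_mono mult_left_mono mult_pos_pos) auto
  also have "\<dots> = 6 * (1 / (sqrt (2 * pi) * (3 * s)))"
    using s by (simp add: field_simps)
  also have "sqrt (2 * pi) * (3 * s) = sqrt (2 * pi * (3 * s)\<^sup>2)"
    unfolding real_sqrt_mult[of "2 * pi"] using s by (simp only: real_sqrt_abs)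
  finally have "1 / sqrt (2 * pi * \<sigma>\<^sup>2) * exp (- (x - \<mu>)\<^sup>2 / (2 * \<sigma>\<^sup>2)) \<le>
      6 * (1 / sqrt (2 * pi * (3 * s)\<^sup>2)) * (exp (1 / 2) * exp (- (x - \<mu>0)\<^sup>2 / (2 * (3 * s)\<^sup>2)))"
    using E by (intro mult_mono) auto
  then show ?thesis unfolding normal_density_def by (simp add: mult_ac)
qed

section \<open>Scores and the gradient of the Gaussian integral\<close>

text \<open>This and \<open>score_sd\<close> are the partial derivatives of the logarithm of the
  density in the mean and in the standard deviation. They are encoded as polynomials in
  \<open>x\<close> because they later serve as test polynomials, for which a degree is
  needed.\<close>

definition score_mean :: "real \<Rightarrow> real \<Rightarrow> real poly" where
  "score_mean \<mu> \<sigma> = [:- \<mu> / \<sigma>\<^sup>2, 1 / \<sigma>\<^sup>2:]"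

definition score_sd :: "real \<Rightarrow> real \<Rightarrow> real poly" where
  "score_sd \<mu> \<sigma> = [:\<mu>\<^sup>2 / \<sigma> ^ 3 - 1 / \<sigma>, - 2 * \<mu> / \<sigma> ^ 3, 1 / \<sigma> ^ 3:]"

lemma poly_score_mean: "poly (score_mean \<mu> \<sigma>) x = (x - \<mu>) / \<sigma>\<^sup>2"
  unfolding score_mean_def by (simp add: diff_divide_distrib)

lemma poly_score_sd: "poly (score_sd \<mu> \<sigma>) x = (x - \<mu>)\<^sup>2 / \<sigma> ^ 3 - 1 / \<sigma>"
  unfolding score_sd_def by (simp add: power2_eq_square divide_inverse algebra_simps)

text \<open>The derivative of a positive function is the function times its logarithmic derivative,
  here the combination of the two scores along \<open>h\<close>. The computation takes \<sigma> out
  of the square root, which is valid for positive \<sigma>, and is transferred back on the open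
  half-plane.\<close>

lemma normal_density_has_derivative:
  assumes "snd y > 0"
  shows "((\<lambda>y. normal_density (fst y) (snd y) x) has_derivative
    (\<lambda>h. normal_density (fst y) (snd y) x *
      (fst h * poly (score_mean (fst y) (snd y)) x + snd h * poly (score_sd (fst y) (snd y)) x))) (at y)"
proof -
  obtain \<mu> \<sigma> where y: "y = (\<mu>, \<sigma>)" by fastforce
  have \<sigma>: "\<sigma> > 0" using assms y by simp
  have eq: "normal_density m d x = 1 / (sqrt (2 * pi) * d) * exp (- (x - m)\<^sup>2 / (2 * d\<^sup>2))"
    if "d > 0" for m d
    using that unfolding normal_density_def by (simp add: real_sqrt_mult)
  have 1: "((\<lambda>y. 1 / (sqrt (2 * pi) * snd y)) has_derivative
      (\<lambda>h. - snd h / \<sigma> * (1 / (sqrt (2 * pi) * \<sigma>)))) (at y)"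
    by (rule derivative_eq_intros refl | use \<sigma> y in \<open>simp add: field_simps\<close>)+
  \<comment> \<open>Brings the quotient-rule output for the exponent, with \<open>a\<close>,
    \<open>b\<close> the components of the direction and \<open>u = x - \<mu>\<close>, into the form
    of the scores.\<close>
  have eq2: "- ((- (4 * (a * (u * \<sigma>\<^sup>2))) - u\<^sup>2 * (4 * (b * \<sigma>))) / (4 * \<sigma> ^ 4)) =
      a * u / \<sigma>\<^sup>2 + b * u\<^sup>2 / \<sigma> ^ 3" for a b u
    using \<sigma> by (simp add: divide_simps) (simp add: algebra_simps eval_nat_numeral)
  have 2: "((\<lambda>y. - (x - fst y)\<^sup>2 / (2 * (snd y)\<^sup>2)) has_derivative
      (\<lambda>h. fst h * (x - \<mu>) / \<sigma>\<^sup>2 + snd h * (x - \<mu>)\<^sup>2 / \<sigma> ^ 3)) (at y)"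
    using \<sigma> by (auto intro!: derivative_eq_intros simp: y eq2)
  have 3: "((\<lambda>y. 1 / (sqrt (2 * pi) * snd y) * exp (- (x - fst y)\<^sup>2 / (2 * (snd y)\<^sup>2))) has_derivative
    (\<lambda>h. normal_density (fst y) (snd y) x *
      (fst h * poly (score_mean (fst y) (snd y)) x + snd h * poly (score_sd (fst y) (snd y)) x))) (at y)"
    using has_derivative_mult[OF 1 has_derivative_exp[OF 2]]
    unfolding y fst_conv snd_conv eq[OF \<sigma>] poly_score_mean poly_score_sd
    by (rule has_derivative_eq_rhs)
      (simp add: fun_eq_iff add_divide_distrib diff_divide_distrib algebra_simps)
  have "open (snd -` {0<..} :: (real \<times> real) set)"
    by (intro open_vimage_snd) simp
  then show ?thesis
    by (rule has_derivative_transform_within_open[OF 3]) (use assms eq in auto)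
qed

text \<open>Differentiation under the integral, with the ball of radius \<sigma>/2 as neighbourhood.
  The dominating function is \<bar>f\<bar> times a score bound \<open>P\<close> times the wider
  Gaussian, integrable because polynomial growth is preserved by products.\<close>

lemma gauss_integral_GDERIV:
  assumes f: "poly_growth f" and s: "\<sigma> > 0"
  shows "GDERIV (gauss_integral f) (\<mu>, \<sigma>) :>
    (gauss_integral (\<lambda>x. f x * poly (score_mean \<mu> \<sigma>) x) (\<mu>, \<sigma>),
     gauss_integral (\<lambda>x. f x * poly (score_sd \<mu> \<sigma>) x) (\<mu>, \<sigma>))"
proof -
  define g' where "g' y x h = f x * (normal_density (fst y) (snd y) x *
      (fst h * poly (score_mean (fst y) (snd y)) x + snd h * poly (score_sd (fst y) (snd y)) x))"
    for y h :: "real \<times> real" and x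
  \<comment> \<open>\<open>\<bar>x - \<mu>\<bar> + \<sigma>\<close> bounds the distance from
    \<open>x\<close> to every nearby mean; 4, 8 and 2 arise from replacing the deviation by its
    lower bound \<sigma>/2 in the denominators. The square is written as a product to fit the
    closure rules of \<open>poly_growth\<close>.\<close>
  define P where "P = (\<lambda>x. (\<bar>x - \<mu>\<bar> + \<sigma>) * (4 / \<sigma>\<^sup>2) + (\<bar>x - \<mu>\<bar> + \<sigma>) * (\<bar>x - \<mu>\<bar> + \<sigma>) * (8 / \<sigma> ^ 3) + 2 / \<sigma>)"
  \<comment> \<open>The radius \<sigma>/2 keeps the deviation away from 0 and yields exactly the
    parameter ranges of \<open>normal_density_le_wider\<close>.\<close>
  have near: "\<bar>fst y - \<mu>\<bar> \<le> \<sigma> / 2" "\<sigma> / 2 \<le> snd y" "snd y \<le> 3 * \<sigma> / 2" if "y \<in> ball (\<mu>, \<sigma>) (\<sigma> / 2)" for y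
    using dist_fst_le[of y "(\<mu>, \<sigma>)"] dist_snd_le[of y "(\<mu>, \<sigma>)"] that
    by (auto simp: dist_real_def dist_commute)
  have fm: "f \<in> borel_measurable borel" using f unfolding poly_growth_def by simp
  have pm: "poly p \<in> borel_measurable borel" for p :: "real poly"
    using poly_growth_poly[of p] unfolding poly_growth_def by simp
  have "((\<lambda>y. LINT x|lborel. f x * normal_density (fst y) (snd y) x) has_derivative
      (\<lambda>h. LINT x|lborel. g' (\<mu>, \<sigma>) x h)) (at (\<mu>, \<sigma>))"
  proof (rule has_derivative_lebesgue_integral[where r = "\<sigma> / 2" and
        w = "\<lambda>x. 6 * exp (1 / 2) * ((\<bar>f x\<bar> * P x) * normal_density \<mu> (3 * \<sigma>) x)"])
    show "\<sigma> / 2 > 0" using s by simp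
    show "integrable lborel (\<lambda>x. f x * normal_density (fst y) (snd y) x)" if "y \<in> ball (\<mu>, \<sigma>) (\<sigma> / 2)" for y
      using near[OF that] s by (intro integrable_poly_growth_normal f) linarith
    show "((\<lambda>y. f x * normal_density (fst y) (snd y) x) has_derivative g' y x) (at y)"
      if "y \<in> ball (\<mu>, \<sigma>) (\<sigma> / 2)" for x y
      unfolding g'_def
      using near[OF that] s by (intro has_derivative_mult_right normal_density_has_derivative) linarith
    show "(\<lambda>x. g' (\<mu>, \<sigma>) x h) \<in> borel_measurable lborel" for h
      unfolding g'_def using fm pm by measurable
    have "poly_growth P"
      unfolding P_def
      by (intro poly_growth_add poly_growth_mult poly_growth_abs poly_growth_diff poly_growth_const poly_growth_id)
    then show "integrable lborel (\<lambda>x. 6 * exp (1 / 2) * ((\<bar>f x\<bar> * P x) * normal_density \<mu> (3 * \<sigma>) x))"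
      using s f by (intro integrable_mult_right integrable_poly_growth_normal poly_growth_mult poly_growth_abs) auto
    fix x h and y :: "real \<times> real" assume y: "y \<in> ball (\<mu>, \<sigma>) (\<sigma> / 2)"
    note n = near[OF y]
    have y0: "snd y > 0" using n s by linarith
    define d where "d = \<bar>x - \<mu>\<bar> + \<sigma>"
    have d: "\<bar>x - fst y\<bar> \<le> d" "d \<ge> 0" unfolding d_def using n s by linarith+
    have sm: "\<bar>poly (score_mean (fst y) (snd y)) x\<bar> \<le> d * (4 / \<sigma>\<^sup>2)"
    proof -
      have "\<bar>x - fst y\<bar> / (snd y)\<^sup>2 \<le> d / (\<sigma> / 2)\<^sup>2"
        using d n s by (intro frac_le power_mono) auto
      then show ?thesis unfolding poly_score_mean by (simp add: power_divide mult_ac)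
    qed
    have ss: "\<bar>poly (score_sd (fst y) (snd y)) x\<bar> \<le> d * d * (8 / \<sigma> ^ 3) + 2 / \<sigma>"
    proof -
      have "(x - fst y)\<^sup>2 \<le> d\<^sup>2" using d by (metis abs_ge_zero power2_abs power_mono)
      then have "(x - fst y)\<^sup>2 / snd y ^ 3 \<le> d\<^sup>2 / (\<sigma> / 2) ^ 3"
        using n s by (intro frac_le) (auto intro: power_mono)
      moreover have "1 / snd y \<le> 1 / (\<sigma> / 2)" using n s by (intro frac_le) auto
      moreover have "(x - fst y)\<^sup>2 / snd y ^ 3 \<ge> 0" "1 / snd y \<ge> 0" using y0 by auto
      moreover have "\<bar>u - v\<bar> \<le> a + b" if "u \<le> a" "v \<le> b" "0 \<le> u" "0 \<le> v" for a b u v :: real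
        using that by linarith
      ultimately have "\<bar>poly (score_sd (fst y) (snd y)) x\<bar> \<le> d\<^sup>2 / (\<sigma> / 2) ^ 3 + 1 / (\<sigma> / 2)"
        unfolding poly_score_sd by blast
      then show ?thesis by (simp add: power_divide power2_eq_square mult_ac)
    qed
    have "\<bar>fst h * poly (score_mean (fst y) (snd y)) x + snd h * poly (score_sd (fst y) (snd y)) x\<bar>
        \<le> \<bar>fst h\<bar> * \<bar>poly (score_mean (fst y) (snd y)) x\<bar> + \<bar>snd h\<bar> * \<bar>poly (score_sd (fst y) (snd y)) x\<bar>"
      by (metis abs_mult abs_triangle_ineq)
    also have "\<dots> \<le> norm h * (d * (4 / \<sigma>\<^sup>2)) + norm h * (d * d * (8 / \<sigma> ^ 3) + 2 / \<sigma>)"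
      using sm ss norm_fst_le[of "fst h" "snd h"] norm_snd_le[of "snd h" "fst h"]
      by (intro add_mono mult_mono) auto
    also have "\<dots> = P x * norm h" unfolding P_def d_def by (simp add: algebra_simps)
    finally have 1: "\<bar>fst h * poly (score_mean (fst y) (snd y)) x + snd h * poly (score_sd (fst y) (snd y)) x\<bar>
        \<le> P x * norm h" .
    have "\<bar>g' y x h\<bar> \<le> \<bar>f x\<bar> * ((6 * exp (1 / 2) * normal_density \<mu> (3 * \<sigma>) x) * (P x * norm h))"
      unfolding g'_def abs_mult[of "f x"] abs_mult[of "normal_density _ _ _"]
      using normal_density_le_wider[OF s n, of x] 1 by (intro mult_left_mono mult_mono) auto
    then show "\<bar>g' y x h\<bar> \<le> 6 * exp (1 / 2) * ((\<bar>f x\<bar> * P x) * normal_density \<mu> (3 * \<sigma>) x) * norm h"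
      by (simp add: mult_ac)
  qed
  \<comment> \<open>A gradient represents the derivative as an inner product with \<open>h\<close>;
    linearity of the integral separates the two components.\<close>
  moreover have "(LINT x|lborel. g' (\<mu>, \<sigma>) x h) =
      h \<bullet> (gauss_integral (\<lambda>x. f x * poly (score_mean \<mu> \<sigma>) x) (\<mu>, \<sigma>),
           gauss_integral (\<lambda>x. f x * poly (score_sd \<mu> \<sigma>) x) (\<mu>, \<sigma>))" for h
  proof -
    have "integrable lborel (\<lambda>x. (f x * poly p x) * normal_density \<mu> \<sigma> x)" for p
      using s by (intro integrable_poly_growth_normal poly_growth_mult f poly_growth_poly)
    moreover have "g' (\<mu>, \<sigma>) x h = fst h * ((f x * poly (score_mean \<mu> \<sigma>) x) * normal_density \<mu> \<sigma> x)
        + snd h * ((f x * poly (score_sd \<mu> \<sigma>) x) * normal_density \<mu> \<sigma> x)" for x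
      unfolding g'_def by (simp add: algebra_simps)
    ultimately show ?thesis unfolding gauss_integral_def by (simp add: inner_prod_def)
  qed
  ultimately show ?thesis
    unfolding gderiv_def gauss_integral_def case_prod_beta by simp
qed

section \<open>Orthogonality of the minimizer's error\<close>

text \<open>Near \<open>t = 0\<close> the linear term dominates the quadratic one, so a nonzero
  \<open>a\<close> would make the expression negative for a suitable sign of
  \<open>t\<close>.\<close>

lemma linear_term_zero:
  fixes a b :: real
  assumes "\<And>t. 0 \<le> t * a + t\<^sup>2 * b"
  shows "a = 0"
proof (rule ccontr)
  assume "a \<noteq> 0"
  \<comment> \<open>A positive \<open>k\<close> above \<open>b\<close> makes the witness
    \<open>t = - a / k\<close> well defined and its value
    \<open>a\<^sup>2 / k\<^sup>2 * (b - k)\<close> negative.\<close>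
  define k where "k = \<bar>b\<bar> + 1"
  have "k > 0" "b < k" unfolding k_def by auto
  have "(- a / k) * a + (- a / k)\<^sup>2 * b = a\<^sup>2 / k\<^sup>2 * (b - k)"
    using \<open>k > 0\<close> by (simp add: field_simps power2_eq_square)
  also have "\<dots> < 0" using \<open>a \<noteq> 0\<close> \<open>k > 0\<close> \<open>b < k\<close> by (intro mult_pos_neg) auto
  finally show False using assms[of "- a / k"] by simp
qed

text \<open>First-order variation: along the line \<open>q + smult t p\<close> of admissible
  polynomials the error is quadratic in \<open>t\<close> with its minimum at \<open>t = 0\<close>,
  so the linear coefficient vanishes. That coefficient is twice the inner product of
  \<open>poly q - f\<close> with \<open>p\<close> in the Gaussian L2 space.\<close>

lemma gauss_sq_error_minimizer_orthogonal:
  assumes f: "poly_growth f" and s: "\<sigma> > 0"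
    and min: "is_arg_min (gauss_sq_error f \<mu> \<sigma>) (\<lambda>q. degree q \<le> n) q"
    and p: "degree p \<le> n"
  shows "gauss_integral (\<lambda>x. f x * poly p x) (\<mu>, \<sigma>) = gauss_integral (\<lambda>x. poly q x * poly p x) (\<mu>, \<sigma>)"
proof -
  let ?N = "normal_density \<mu> \<sigma>"
  note I = integrable_poly_growth_normal[OF _ s, of _ \<mu>]
  have e: "poly_growth (\<lambda>x. poly q x - f x)" by (intro poly_growth_diff poly_growth_poly f)
  have i0: "integrable lborel (\<lambda>x. ((poly q x - f x) * (poly q x - f x)) * ?N x)"
    by (intro I poly_growth_mult e)
  have i1: "integrable lborel (\<lambda>x. ((poly q x - f x) * poly p x) * ?N x)"
    by (intro I poly_growth_mult e poly_growth_poly)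
  have i2: "integrable lborel (\<lambda>x. (poly p x * poly p x) * ?N x)"
    by (intro I poly_growth_mult poly_growth_poly)
  \<comment> \<open>\<open>A\<close> is the inner product of the error with \<open>p\<close>, and
    \<open>B\<close> the squared norm of \<open>p\<close>, in the Gaussian L2 space.\<close>
  define A where "A = (LINT x|lborel. ((poly q x - f x) * poly p x) * ?N x)"
  define B where "B = (LINT x|lborel. (poly p x * poly p x) * ?N x)"
  have E: "gauss_sq_error f \<mu> \<sigma> (q + smult t p) = gauss_sq_error f \<mu> \<sigma> q + t * (2 * A) + t\<^sup>2 * B" for t
  proof -
    have "gauss_sq_error f \<mu> \<sigma> (q + smult t p) = (LINT x|lborel.
        ((poly q x - f x) * (poly q x - f x)) * ?N x + 2 * t * (((poly q x - f x) * poly p x) * ?N x)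
        + t\<^sup>2 * ((poly p x * poly p x) * ?N x))"
      unfolding gauss_sq_error_def
      by (intro Bochner_Integration.integral_cong) (auto simp: power2_eq_square algebra_simps)
    also have "\<dots> = gauss_sq_error f \<mu> \<sigma> q + t * (2 * A) + t\<^sup>2 * B"
      using i0 i1 i2 unfolding gauss_sq_error_def A_def B_def by (simp add: power2_eq_square)
    finally show ?thesis .
  qed
  have "2 * A = 0"
  proof (rule linear_term_zero)
    fix t
    have "degree (q + smult t p) \<le> n"
      using min p degree_smult_le[of t p] unfolding is_arg_min_def by (intro degree_add_le) auto
    then have "gauss_sq_error f \<mu> \<sigma> q \<le> gauss_sq_error f \<mu> \<sigma> (q + smult t p)"
      using min unfolding is_arg_min_def by force
    then show "0 \<le> t * (2 * A) + t\<^sup>2 * B" unfolding E by simp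
  qed
  moreover have "A = gauss_integral (\<lambda>x. poly q x * poly p x) (\<mu>, \<sigma>) - gauss_integral (\<lambda>x. f x * poly p x) (\<mu>, \<sigma>)"
    unfolding A_def gauss_integral_def left_diff_distrib prod.case
    by (intro Bochner_Integration.integral_diff I poly_growth_mult poly_growth_poly f)
  ultimately show ?thesis by simp
qed

theorem corollary2p15:
  fixes f :: "real \<Rightarrow> real"
    and \<mu>\<^sub>j \<sigma>\<^sub>j a\<^sub>j b\<^sub>j c\<^sub>j :: real
    and q\<^sub>j :: "real poly"
  assumes "f \<in> C_p"
    and "\<sigma>\<^sub>j > 0"
    and "q\<^sub>j = [:a\<^sub>j, b\<^sub>j, c\<^sub>j:]"
    and "is_arg_min (gauss_sq_error f \<mu>\<^sub>j \<sigma>\<^sub>j) (\<lambda>q. degree q \<le> 2) q\<^sub>j"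
  shows "\<exists>D. GDERIV (gauss_integral f) (\<mu>\<^sub>j, \<sigma>\<^sub>j) :> D \<and>
             GDERIV (gauss_integral (poly q\<^sub>j)) (\<mu>\<^sub>j, \<sigma>\<^sub>j) :> D"
proof -
  have f: "poly_growth f" using assms(1) by (rule C_p_poly_growth)
  \<comment> \<open>Degree at most 2 admits both scores as test polynomials, so the two gradient
    formulas agree componentwise.\<close>
  have "degree (score_mean \<mu>\<^sub>j \<sigma>\<^sub>j) \<le> 2" "degree (score_sd \<mu>\<^sub>j \<sigma>\<^sub>j) \<le> 2"
    unfolding score_mean_def score_sd_def by auto
  then show ?thesis
    using gauss_integral_GDERIV[OF f assms(2), of \<mu>\<^sub>j]
      gauss_integral_GDERIV[OF poly_growth_poly assms(2), of q\<^sub>j \<mu>\<^sub>j]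
      gauss_sq_error_minimizer_orthogonal[OF f assms(2,4)]
    by auto
qed

end
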